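(* Let $A\in\mathsf{S}^d(\mathbb{R}^n)$ be a real symmetric $d$-tensor. Then \[ \|A\|_{*,\mathbb{R}}=\min\Bigl\{\sum_{i=1}^r\|x_i\|^d : A=\sum_{i=1}^r\varepsilon_i x_i^{\otimes d},\ x_i\in\mathbb{R}^n,\ \varepsilon_i\in\{-1,1\},\ r\in\mathbb{N}\Bigr\}, \] and the infimum over all such symmetric rank-one decompositions is attained.
   Context: $\mathsf{S}^d(\mathbb{R}^n)$ is the space of symmetric tensors in $(\mathbb{R}^n)^{\otimes d}=\mathbb{R}^{n\times\dots\times n}$ (entries invariant under permutation of indices); $x^{\otimes d}=x\otimes\dots\otimes x$. $\|\cdot\|$ is the Euclidean norm. The nuclear norm is $\|A\|_{*,\mathbb{R}}=\inf\{\sum_{i=1}^r\|x_{1,i}\|\cdots\|x_{d,i}\| : A=\sum_{i=1}^r x_{1,i}\otimes\dots\otimes x_{d,i},\ x_{k,i}\in\mathbb{R}^n,\ r\in\mathbb{N}\}$. *)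

theory Defs
  imports "HOL-Analysis.Analysis"
begin

(* The order d >= 1 and the dimension n >= 1 are the cardinalities of the finite index
   types 'd and 'n; an entry A_{i_1,...,i_d} of A is A $ i for the multi-index i :: 'd => 'n. *)

type_synonym ('n, 'd) tensor = "(real, 'd \<Rightarrow> 'n) vec"

definition symmetric_tensor :: "('n::finite, 'd::finite) tensor \<Rightarrow> bool" where
  "symmetric_tensor A \<longleftrightarrow> (\<forall>\<sigma>. \<sigma> permutes UNIV \<longrightarrow> (\<forall>i. A $ (i \<circ> \<sigma>) = A $ i))"

definition rank_one_tensor :: "('d \<Rightarrow> real ^ 'n) \<Rightarrow> ('n::finite, 'd::finite) tensor" where
  "rank_one_tensor v = (\<chi> i. \<Prod>k\<in>UNIV. v k $ i k)"

definition tensor_power :: "real ^ 'n \<Rightarrow> ('n::finite, 'd::finite) tensor" where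
  "tensor_power v = rank_one_tensor (\<lambda>_. v)"

definition nuclear_norm :: "('n::finite, 'd::finite) tensor \<Rightarrow> real" where
  "nuclear_norm A = Inf {(\<Sum>i<r. \<Prod>k\<in>UNIV. norm (x k i)) | (r :: nat) (x :: 'd \<Rightarrow> nat \<Rightarrow> real ^ 'n).
     A = (\<Sum>i<r. rank_one_tensor (\<lambda>k. x k i))}"

definition symmetric_decomposition_costs :: "('n::finite, 'd::finite) tensor \<Rightarrow> real set" where
  "symmetric_decomposition_costs A =
     {(\<Sum>i<r. norm (x i) ^ CARD('d)) | (r :: nat) (x :: nat \<Rightarrow> real ^ 'n) (\<epsilon> :: nat \<Rightarrow> real).
       (\<forall>i<r. \<epsilon> i \<in> {-1, 1}) \<and> A = (\<Sum>i<r. \<epsilon> i *\<^sub>R tensor_power (x i))}"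

end

theory Submission imports Defs begin

text \<open>Let \<open>N\<close> be the nuclear norm of \<open>A\<close>. If \<open>A\<close> were outside \<open>N\<close> times the (compact) convex hull of
  the signed powers of unit vectors, a linear functional \<open>B\<close> would separate it, and by orthogonal
  projection \<open>B\<close> may be taken symmetric. By Banach's theorem the symmetric multilinear form given by
  \<open>B\<close> has the same maximum on unit vectors as on the diagonal, which bounds \<open>B \<bullet> A\<close> by \<open>N\<close> times
  that maximum, a contradiction. So \<open>A\<close> is a symmetric decomposition of cost exactly \<open>N\<close>.

  For Banach's theorem, take among all unit maximisers \<open>u\<close> of the absolute value of the form
  one that maximises the sum of the numbers \<open>\<bar>u\<^sub>j \<bullet> e\<bar>\<close>, for \<open>e\<close> an entry of some maximiser.
  After sign changes all \<open>u\<^sub>j \<bullet> e\<close> are nonnegative and one is positive. Replacing that entry and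
  a different one by their normalised sum again gives a maximiser, by polarisation and the
  parallelogram law, but strictly increases the sum; so all entries are equal.\<close>

text \<open>By polarisation, \<open>4 * M\<close> is at most the sum of the absolute values of the
  form at \<open>x + y\<close> and \<open>x - y\<close>. By the parallelogram law,
  \<open>4 * M\<close> is also the sum of the two upper bounds from \<open>bd\<close>. Hence both
  bounds are equalities.\<close>

lemma bilinear_sym_max_on_sum:
  fixes G :: "'a::real_inner \<Rightarrow> 'a \<Rightarrow> real"
  assumes G: "bilinear G" and sym: "\<And>x y. G y x = G x y"
    and bd: "\<And>x. \<bar>G x x\<bar> \<le> M * (norm x)\<^sup>2"
    and "norm x = 1" "norm y = 1" "\<bar>G x y\<bar> = M"
  shows "\<bar>G (x + y) (x + y)\<bar> = M * (norm (x + y))\<^sup>2"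
proof -
  have "G (x + y) (x + y) - G (x - y) (x - y) = 4 * G x y"
    using sym[of y x] by (simp add: bilinear_ladd[OF G] bilinear_radd[OF G] bilinear_lsub[OF G] bilinear_rsub[OF G])
  then have "4 * M \<le> \<bar>G (x + y) (x + y)\<bar> + \<bar>G (x - y) (x - y)\<bar>"
    using assms(6) by linarith
  moreover have "M * (norm (x + y))\<^sup>2 + M * (norm (x - y))\<^sup>2 = 4 * M"
  proof -
    have "(norm (x + y))\<^sup>2 + (norm (x - y))\<^sup>2 = 4"
      using assms(4,5) by (simp add: power2_norm_eq_inner inner_add inner_diff inner_commute norm_eq_1)
    then show ?thesis by (simp flip: distrib_left)
  qed
  ultimately show ?thesis using bd[of "x + y"] bd[of "x - y"] by linarith
qed

section \<open>Multilinearity and continuity of rank-one tensors\<close>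

lemma vec_nth_vec_lambda [simp]: "($) (vec_lambda v) = v"
  by (simp add: fun_eq_iff)

lemma rank_one_tensor_nth [simp]: "rank_one_tensor v $ i = (\<Prod>k\<in>UNIV. v k $ i k)"
  by (simp add: rank_one_tensor_def)

lemma rank_one_tensor_upd_nth:
  "rank_one_tensor (v(j := x)) $ i = x $ i j * (\<Prod>k\<in>UNIV - {j}. v k $ i k)"
  by (simp add: prod.remove[of UNIV j])

lemma linear_rank_one_tensor_upd: "linear (\<lambda>x. rank_one_tensor (v(j := x)))"
  by (rule linearI) (simp_all add: vec_eq_iff rank_one_tensor_upd_nth algebra_simps
      del: rank_one_tensor_nth)

lemma rank_one_tensor_scaleR:
  fixes v :: "'d::finite \<Rightarrow> real ^ 'n::finite"
  shows "rank_one_tensor (\<lambda>k. c k *\<^sub>R v k) = (\<Prod>k\<in>UNIV. c k) *\<^sub>R rank_one_tensor v"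
  by (simp add: vec_eq_iff prod.distrib)

lemma tensor_power_scaleR:
  "(tensor_power (c *\<^sub>R x) :: ('n::finite, 'd::finite) tensor) = c ^ CARD('d) *\<^sub>R tensor_power x"
  unfolding tensor_power_def by (simp add: rank_one_tensor_scaleR)

lemma continuous_on_rank_one_tensor:
  "continuous_on S (\<lambda>u :: real ^ 'n ^ 'd. rank_one_tensor (($) u) :: ('n::finite, 'd::finite) tensor)"
  unfolding rank_one_tensor_def by (intro continuous_intros)

lemma continuous_on_tensor_power:
  "continuous_on S (tensor_power :: real ^ 'n \<Rightarrow> ('n::finite, 'd::finite) tensor)"
  unfolding rank_one_tensor_def tensor_power_def by (intro continuous_intros)

section \<open>Symmetric tensors\<close>

lemma symmetric_tensor_power: "symmetric_tensor (tensor_power x :: ('n::finite, 'd::finite) tensor)"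
proof -
  have "(\<Prod>k\<in>UNIV. x $ i (\<sigma> k)) = (\<Prod>k\<in>UNIV. x $ i k)" if "\<sigma> permutes UNIV" for \<sigma> and i :: "'d \<Rightarrow> 'n"
    using prod.permute[OF that, of "\<lambda>k. x $ i k"] by (simp add: o_def)
  then show ?thesis by (simp add: symmetric_tensor_def tensor_power_def)
qed

lemma subspace_symmetric_tensor: "subspace (Collect symmetric_tensor)"
  by (auto simp: subspace_def symmetric_tensor_def)

text \<open>Reindexing the sum over multi-indices by \<open>i \<mapsto> i \<circ> \<sigma>\<close>
  moves the permutation from the vectors to the entries of \<open>B\<close>, where symmetry absorbs
  it.\<close>

lemma inner_symmetric_tensor_permute:
  fixes B :: "('n::finite, 'd::finite) tensor"
  assumes "symmetric_tensor B" and p: "\<sigma> permutes UNIV"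
  shows "B \<bullet> rank_one_tensor (v \<circ> \<sigma>) = B \<bullet> rank_one_tensor v"
proof -
  have r: "(\<Prod>k\<in>UNIV. v (\<sigma> k) $ (i \<circ> \<sigma>) k) = (\<Prod>k\<in>UNIV. v k $ i k)" for i
    using prod.permute[OF p, of "\<lambda>k. v k $ i k"] by (simp add: o_def)
  have bij: "bij (\<lambda>i :: 'd \<Rightarrow> 'n. i \<circ> \<sigma>)"
    by (rule bij_betw_byWitness[where f' = "\<lambda>i. i \<circ> inv \<sigma>"])
      (auto simp: o_assoc[symmetric] permutes_inv_o[OF p])
  have "B \<bullet> rank_one_tensor (v \<circ> \<sigma>) = (\<Sum>i\<in>UNIV. B $ (i \<circ> \<sigma>) * (\<Prod>k\<in>UNIV. v (\<sigma> k) $ (i \<circ> \<sigma>) k))"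
    using sum.reindex_bij_betw[OF bij, of "\<lambda>i. B $ i * (\<Prod>k\<in>UNIV. v (\<sigma> k) $ i k)"]
    by (simp add: inner_vec_def)
  also have "\<dots> = B \<bullet> rank_one_tensor v"
    unfolding r using assms by (simp add: symmetric_tensor_def inner_vec_def)
  finally show ?thesis .
qed

section \<open>Banach's theorem on symmetric multilinear forms\<close>

lemma norm_bound_rank_one:
  fixes B :: "('n::finite, 'd::finite) tensor"
  assumes "\<And>v. (\<forall>k. norm (v k) = 1) \<Longrightarrow> \<bar>B \<bullet> rank_one_tensor v\<bar> \<le> M"
  shows "\<bar>B \<bullet> rank_one_tensor v\<bar> \<le> M * (\<Prod>k\<in>UNIV. norm (v k))"
proof (cases "\<exists>k. v k = 0")
  case True
  then obtain k where k: "v k = 0" by blast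
  then have "(\<Prod>k\<in>UNIV. v k $ i k) = 0" for i by (intro prod_zero bexI[of _ k]) auto
  then have "rank_one_tensor v = 0" by (simp add: vec_eq_iff)
  moreover have "(\<Prod>k\<in>UNIV. norm (v k)) = 0" using k by (intro prod_zero bexI[of _ k]) auto
  ultimately show ?thesis by (simp only: inner_zero_right abs_zero mult_zero_right order_refl)
next
  case False
  \<comment> \<open>Homogeneity in each slot reduces the bound to unit vectors.\<close>
  define w where "w k = v k /\<^sub>R norm (v k)" for k
  have v: "v = (\<lambda>k. norm (v k) *\<^sub>R w k)" using False by (simp add: w_def fun_eq_iff)
  have "rank_one_tensor v = (\<Prod>k\<in>UNIV. norm (v k)) *\<^sub>R rank_one_tensor w"
    by (subst v) (simp only: rank_one_tensor_scaleR)
  moreover have "\<bar>B \<bullet> rank_one_tensor w\<bar> \<le> M"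
    using False by (intro assms) (simp add: w_def)
  ultimately show ?thesis
    by (simp add: abs_mult abs_prod mult.commute[of M] mult_left_mono prod_nonneg)
qed

theorem banach_symmetric_max:
  fixes B :: "('n::finite, 'd::finite) tensor"
  assumes sym: "symmetric_tensor B"
  obtains x :: "real ^ 'n" where "norm x = 1"
    "\<And>v. (\<forall>k. norm (v k) = 1) \<Longrightarrow> \<bar>B \<bullet> rank_one_tensor v\<bar> \<le> \<bar>B \<bullet> tensor_power x\<bar>"
proof -
  define F where "F v = \<bar>B \<bullet> rank_one_tensor v\<bar>" for v
  \<comment> \<open>The product of unit spheres is encoded in the Euclidean space
    \<open>real ^ 'n ^ 'd\<close>, so that closed and bounded gives compact.\<close>
  define U where "U = {u :: real ^ 'n ^ 'd. \<forall>k. norm (u $ k) = 1}"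
  have F_cont: "continuous_on T (\<lambda>u :: real ^ 'n ^ 'd. F (($) u))" for T
    unfolding F_def by (intro continuous_intros continuous_on_rank_one_tensor)
  have "closed U"
    unfolding U_def by (intro closed_Collect_all closed_Collect_eq continuous_intros)
  moreover have "bounded U"
  proof -
    have "norm u \<le> real CARD('d)" if "u \<in> U" for u
      using that L2_set_le_sum[of UNIV "\<lambda>k. norm (u $ k)"]
      by (simp add: U_def norm_vec_def)
    then show ?thesis by (auto simp: bounded_iff)
  qed
  ultimately have U: "compact U" by (simp add: compact_eq_bounded_closed)
  have "(\<chi> k. axis undefined 1) \<in> U" by (simp add: U_def)
  then have "U \<noteq> {}" by blast
  then obtain u0 where u0: "u0 \<in> U" "\<And>u. u \<in> U \<Longrightarrow> F (($) u) \<le> F (($) u0)"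
    using continuous_attains_sup[OF U _ F_cont] by blast
  define M where "M = F (($) u0)"
  have M: "F v \<le> M" if "\<forall>k. norm (v k) = 1" for v
    using u0(2)[of "vec_lambda v"] that by (simp add: U_def M_def)
  obtain k0 :: 'd where True by blast
  \<comment> \<open>Choosing \<open>e\<close> among the entries of the maximiser \<open>u0\<close>
    forces \<open>h\<close> to be at least 1 there, since \<open>e \<bullet> e = 1\<close>. The
    maximum of \<open>h\<close> is then positive.\<close>
  define e where "e = u0 $ k0"
  define h where "h v = (\<Sum>k\<in>UNIV. \<bar>v k \<bullet> e\<bar>)" for v :: "'d \<Rightarrow> real ^ 'n"
  have "compact (U \<inter> {u. F (($) u) = M})"
    by (intro compact_Int_closed U closed_Collect_eq F_cont continuous_intros)
  moreover have "u0 \<in> U \<inter> {u. F (($) u) = M}" by (simp add: u0 M_def)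
  moreover have "continuous_on (U \<inter> {u. F (($) u) = M}) (\<lambda>u. h (($) u))"
    unfolding h_def by (intro continuous_intros)
  ultimately obtain u where uU: "u \<in> U" and uM: "F (($) u) = M"
    and umax: "\<And>u'. u' \<in> U \<Longrightarrow> F (($) u') = M \<Longrightarrow> h (($) u') \<le> h (($) u)"
    using continuous_attains_sup[of "U \<inter> {u. F (($) u) = M}" "\<lambda>u. h (($) u)"] by blast
  \<comment> \<open>Flipping signs changes the form by a factor of absolute value 1 and leaves
    \<open>h\<close> unchanged, so \<open>v\<close> is still optimal for both.\<close>
  define v where "v = (\<lambda>k. (if u $ k \<bullet> e < 0 then -1 else 1) *\<^sub>R u $ k)"
  have v1: "norm (v k) = 1" for k using uU by (simp add: v_def U_def)
  have ve: "v k \<bullet> e \<ge> 0" for k by (simp add: v_def)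
  have hv: "h v = h (($) u)" by (auto simp: h_def v_def intro!: sum.cong)
  have "\<bar>\<Prod>k\<in>UNIV. (if u $ k \<bullet> e < 0 then -1 else 1 :: real)\<bar> = 1"
    by (simp add: abs_prod if_distrib cong: if_cong)
  then have vM: "F v = M"
    using uM by (simp only: F_def v_def rank_one_tensor_scaleR inner_scaleR_right abs_mult mult_1)
  have vmax: "h w \<le> h v" if "\<And>k. norm (w k) = 1" "F w = M" for w
    using umax[of "vec_lambda w"] that hv by (simp add: U_def)
  have "h v > 0"
  proof -
    have "1 = \<bar>u0 $ k0 \<bullet> e\<bar>" using u0(1) by (simp add: e_def U_def power2_norm_eq_inner[symmetric])
    also have "\<dots> \<le> h (($) u0)" unfolding h_def by (rule member_le_sum) auto
    also have "\<dots> \<le> h v" using umax[OF u0(1)] hv by (simp add: M_def)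
    finally show ?thesis by simp
  qed
  have "\<exists>j. v j \<bullet> e \<noteq> 0"
  proof (rule ccontr)
    assume "\<not> ?thesis"
    then have "h v = 0" by (simp add: h_def)
    with \<open>h v > 0\<close> show False by simp
  qed
  then obtain j where j: "v j \<bullet> e > 0" using ve by (metis order_less_le)
  have "v k = v j" for k
  proof (rule ccontr)
    assume ne: "v k \<noteq> v j"
    then have kj: "k \<noteq> j" by blast
    \<comment> \<open>Freezing all slots except \<open>j\<close> and \<open>k\<close> leaves a
      symmetric bilinear form to which polarisation applies.\<close>
    define G where "G x y = B \<bullet> rank_one_tensor (v(j := x, k := y))" for x y
    have lin: "linear (\<lambda>x. B \<bullet> rank_one_tensor (w(l := x)))" for w l
      using linear_compose[OF linear_rank_one_tensor_upd bounded_linear.linear[OF bounded_linear_inner_right]]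
      by (simp add: o_def)
    have "linear (\<lambda>x. G x y)" "linear (G x)" for x y
      using lin[of "v(k := y)" j] lin[of "v(j := x)" k]
      by (simp_all add: G_def[abs_def] fun_upd_twist[OF kj])
    then have bil: "bilinear G" by (simp add: bilinear_def)
    have Gsym: "G y x = G x y" for x y
    proof -
      have "v(j := y, k := x) = v(j := x, k := y) \<circ> Transposition.transpose j k"
        using kj by (auto simp: fun_eq_iff Transposition.transpose_def)
      then show ?thesis
        unfolding G_def
        by (simp only: inner_symmetric_tensor_permute[OF sym permutes_swap_id[OF UNIV_I UNIV_I]])
    qed
    have Gbd: "\<bar>G x x\<bar> \<le> M * (norm x)\<^sup>2" for x
    proof -
      have "(\<Prod>l\<in>UNIV. norm ((v(j := x, k := x)) l)) = (\<Prod>l\<in>{j, k}. norm x)"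
        using v1 by (intro prod.mono_neutral_cong_right) auto
      then show ?thesis
        using norm_bound_rank_one[of B M "v(j := x, k := x)"] M kj
        by (simp add: G_def F_def power2_eq_square)
    qed
    define s where "s = v j + v k"
    have se: "s \<bullet> e > 0" using j ve[of k] by (simp add: s_def inner_add_left)
    then have s0: "norm s > 0" by auto
    have s2: "norm s < 2"
    proof -
      \<comment> \<open>Equality in the triangle inequality would make the two unit vectors
        equal.\<close>
      have "norm s \<noteq> norm (v j) + norm (v k)"
        using ne v1 unfolding s_def norm_triangle_eq by (metis scaleR_one)
      then show ?thesis using norm_triangle_ineq[of "v j" "v k"] v1 by (simp add: s_def)
    qed
    have "\<bar>G s s\<bar> = M * (norm s)\<^sup>2"
      unfolding s_def using vM
      by (intro bilinear_sym_max_on_sum[OF bil Gsym Gbd v1 v1]) (simp add: G_def F_def)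
    define w where "w = s /\<^sub>R norm s"
    have "G w w = G s s / (norm s)\<^sup>2"
      using s0 by (simp add: w_def bilinear_lmul[OF bil] bilinear_rmul[OF bil] field_simps power2_eq_square)
    with \<open>\<bar>G s s\<bar> = _\<close> s0 have "\<bar>G w w\<bar> = M" by simp
    then have le: "h (v(j := w, k := w)) \<le> h v"
      using s0 v1 by (intro vmax) (auto simp: G_def F_def w_def)
    have upd: "h (v(j := a, k := b)) = \<bar>a \<bullet> e\<bar> + \<bar>b \<bullet> e\<bar> + (\<Sum>l\<in>UNIV - {j, k}. \<bar>v l \<bullet> e\<bar>)" for a b
    proof -
      have "h (v(j := a, k := b)) = (\<Sum>l\<in>{j, k}. \<bar>(v(j := a, k := b)) l \<bullet> e\<bar>)
          + (\<Sum>l\<in>UNIV - {j, k}. \<bar>(v(j := a, k := b)) l \<bullet> e\<bar>)"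
        unfolding h_def by (subst sum.subset_diff[of "{j, k}"]) auto
      also have "(\<Sum>l\<in>UNIV - {j, k}. \<bar>(v(j := a, k := b)) l \<bullet> e\<bar>) = (\<Sum>l\<in>UNIV - {j, k}. \<bar>v l \<bullet> e\<bar>)"
        by (rule sum.cong) auto
      also have "(\<Sum>l\<in>{j, k}. \<bar>(v(j := a, k := b)) l \<bullet> e\<bar>) = \<bar>a \<bullet> e\<bar> + \<bar>b \<bullet> e\<bar>"
        using kj by auto
      finally show ?thesis .
    qed
    \<comment> \<open>Only slots \<open>j\<close> and \<open>k\<close> contribute to the change of
      \<open>h\<close>. As \<open>norm s < 2\<close>, normalising \<open>s\<close> gives a vector
      whose product with \<open>e\<close> exceeds half of \<open>s \<bullet> e\<close>, contrary to
      this inequality.\<close>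
    have "2 * (w \<bullet> e) \<le> s \<bullet> e"
      using le upd[of w w] upd[of "v j" "v k"] ve[of j] ve[of k] by (simp add: s_def inner_add_left)
    then have "2 * (s \<bullet> e) \<le> norm s * (s \<bullet> e)"
      using s0 by (simp add: w_def field_simps)
    with se s2 show False by simp
  qed
  then have "v = (\<lambda>_. v j)" by blast
  then have "F v = \<bar>B \<bullet> tensor_power (v j)\<bar>"
    unfolding F_def tensor_power_def by metis
  with M vM show ?thesis by (intro that[of "v j"]) (auto simp: v1 F_def)
qed

section \<open>Costs of rank-one decompositions\<close>

definition nuclear_costs :: "('n::finite, 'd::finite) tensor \<Rightarrow> real set" where
  "nuclear_costs A = {(\<Sum>i<r. \<Prod>k\<in>UNIV. norm (x k i)) | (r :: nat) (x :: 'd \<Rightarrow> nat \<Rightarrow> real ^ 'n).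
     A = (\<Sum>i<r. rank_one_tensor (\<lambda>k. x k i))}"

lemma nuclear_norm_eq: "nuclear_norm A = Inf (nuclear_costs A)"
  by (simp add: nuclear_norm_def nuclear_costs_def)

lemma nuclear_costs_nonneg: "c \<in> nuclear_costs A \<Longrightarrow> c \<ge> 0"
  by (auto simp: nuclear_costs_def intro!: sum_nonneg prod_nonneg)

lemma bdd_below_nuclear_costs: "bdd_below (nuclear_costs A)"
  by (meson bdd_below.I nuclear_costs_nonneg)

lemma nuclear_costs_nonempty: "nuclear_costs (A :: ('n::finite, 'd::finite) tensor) \<noteq> {}"
proof -
  obtain k0 :: 'd where True by blast
  obtain f where f: "bij_betw f {..<CARD('d \<Rightarrow> 'n)} (UNIV :: ('d \<Rightarrow> 'n) set)"
    using ex_bij_betw_nat_finite[of "UNIV :: ('d \<Rightarrow> 'n) set"] by (auto simp: atLeast0LessThan)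
  \<comment> \<open>This is the expansion of \<open>A\<close> in the standard basis; the coefficient
    goes into the single slot \<open>k0\<close> so that it occurs once in the product.\<close>
  define x where "x i k = (if k = k0 then A $ i else 1) *\<^sub>R (axis (i k) 1 :: real ^ 'n)" for i k
  have "(\<Prod>k\<in>UNIV. if i k = j k then 1 else 0 :: real) = (if i = j then 1 else 0)" for i j :: "'d \<Rightarrow> 'n"
    by (auto simp: fun_eq_iff)
  then have x: "rank_one_tensor (x i) $ j = (if i = j then A $ i else 0)" for i j
    unfolding x_def rank_one_tensor_scaleR by (simp add: axis_def eq_commute[of "j _"])
  have "A = (\<Sum>i\<in>UNIV. rank_one_tensor (x i))"
    unfolding vec_eq_iff sum_component x by simp
  also have "\<dots> = (\<Sum>i<CARD('d \<Rightarrow> 'n). rank_one_tensor (\<lambda>k. x (f i) k))"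
    by (rule sum.reindex_bij_betw[OF f, symmetric])
  finally have "(\<Sum>i<CARD('d \<Rightarrow> 'n). \<Prod>k\<in>UNIV. norm (x (f i) k)) \<in> nuclear_costs A"
    unfolding nuclear_costs_def mem_Collect_eq
    by (intro exI[of _ "CARD('d \<Rightarrow> 'n)"] exI[of _ "\<lambda>k i. x (f i) k"] conjI refl)
  then show ?thesis by blast
qed

lemma symmetric_costs_subset:
  "symmetric_decomposition_costs A \<subseteq> nuclear_costs (A :: ('n::finite, 'd::finite) tensor)"
proof
  fix c assume "c \<in> symmetric_decomposition_costs A"
  then obtain r :: nat and x :: "nat \<Rightarrow> real ^ 'n" and \<epsilon> :: "nat \<Rightarrow> real"
    where c: "c = (\<Sum>i<r. norm (x i) ^ CARD('d))" and \<epsilon>: "\<And>i. i < r \<Longrightarrow> \<epsilon> i \<in> {-1, 1}"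
      and A: "A = (\<Sum>i<r. \<epsilon> i *\<^sub>R tensor_power (x i))"
    unfolding symmetric_decomposition_costs_def by blast
  obtain k0 :: 'd where True by blast
  \<comment> \<open>The sign is absorbed into one slot, which leaves all norms unchanged.\<close>
  define y where "y k i = (if k = k0 then \<epsilon> i else 1) *\<^sub>R x i" for k i
  have "A = (\<Sum>i<r. rank_one_tensor (\<lambda>k. y k i))"
    unfolding A y_def rank_one_tensor_scaleR by (simp add: tensor_power_def)
  moreover have "c = (\<Sum>i<r. \<Prod>k\<in>UNIV. norm (y k i))"
    unfolding c
  proof (rule sum.cong)
    fix i assume "i \<in> {..<r}"
    then have "norm (y k i) = norm (x i)" for k using \<epsilon>[of i] by (auto simp: y_def)
    then show "norm (x i) ^ CARD('d) = (\<Prod>k\<in>UNIV. norm (y k i))" by simp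
  qed simp
  ultimately show "c \<in> nuclear_costs A" unfolding nuclear_costs_def by blast
qed

section \<open>Convex hull of signed powers and separation\<close>

definition signed_powers :: "('n::finite, 'd::finite) tensor set" where
  "signed_powers = {\<epsilon> *\<^sub>R tensor_power x | \<epsilon> x. \<epsilon> \<in> {-1, 1} \<and> norm x = 1}"

lemma compact_signed_powers: "compact (signed_powers :: ('n::finite, 'd::finite) tensor set)"
proof -
  let ?f = "\<lambda>p. fst p *\<^sub>R tensor_power (snd p) :: ('n, 'd) tensor"
  have "signed_powers = ?f ` ({-1, 1 :: real} \<times> sphere 0 1)"
    by (force simp: signed_powers_def)
  moreover have "compact (?f ` ({-1, 1 :: real} \<times> sphere 0 1))"
    by (intro compact_continuous_image compact_Times continuous_intros
        continuous_on_compose2[OF continuous_on_tensor_power]) auto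
  ultimately show ?thesis by simp
qed

text \<open>The hull is compact, so strict separation works with the factor
  \<open>nuclear_norm A\<close> itself rather than with slightly larger ones. This is the source of
  attainment.\<close>

lemma nuclear_norm_mem_scaled_hull:
  fixes A :: "('n::finite, 'd::finite) tensor"
  assumes A: "symmetric_tensor A"
  shows "A \<in> (*\<^sub>R) (nuclear_norm A) ` (convex hull signed_powers)"
proof (rule ccontr)
  define N where "N = nuclear_norm A"
  let ?K = "(*\<^sub>R) N ` (convex hull signed_powers)"
  assume "A \<notin> (*\<^sub>R) (nuclear_norm A) ` (convex hull signed_powers)"
  moreover have "closed ?K"
    by (intro compact_imp_closed compact_scaling compact_convex_hull compact_signed_powers)
  moreover have "convex ?K" by (intro convex_scaling convex_convex_hull)
  ultimately obtain a b where ab: "a \<bullet> A < b" "\<And>y. y \<in> ?K \<Longrightarrow> b < a \<bullet> y"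
    using separating_hyperplane_closed_point[of ?K A] unfolding N_def by blast
  \<comment> \<open>Projecting \<open>- a\<close> instead of \<open>a\<close> turns the lower bound
    on the hull into an upper bound for \<open>y\<close>. The projection agrees with
    \<open>- a\<close> on all symmetric tensors, in particular on \<open>A\<close> and on
    powers.\<close>
  obtain y z where yz: "y \<in> span (Collect symmetric_tensor)"
      "\<And>w. w \<in> span (Collect symmetric_tensor) \<Longrightarrow> orthogonal z w" "- a = y + z"
    using orthogonal_subspace_decomp_exists[of "Collect symmetric_tensor" "- a"] by metis
  have y: "symmetric_tensor y" using yz(1) by (simp add: span_eq_iff[THEN iffD2, OF subspace_symmetric_tensor])
  have ya: "y \<bullet> w = - (a \<bullet> w)" if "symmetric_tensor w" for w
  proof -
    have "z \<bullet> w = 0" using yz(2)[of w] that by (simp add: span_base orthogonal_def)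
    moreover have "- (a \<bullet> w) = y \<bullet> w + z \<bullet> w"
      by (simp flip: inner_minus_left inner_add_left yz(3))
    ultimately show ?thesis by simp
  qed
  obtain x :: "real ^ 'n" where x: "norm x = 1"
    "\<And>v. (\<forall>k. norm (v k) = 1) \<Longrightarrow> \<bar>y \<bullet> rank_one_tensor v\<bar> \<le> \<bar>y \<bullet> tensor_power x\<bar>"
    using banach_symmetric_max[OF y] by blast
  define m where "m = \<bar>y \<bullet> tensor_power x\<bar>"
  \<comment> \<open>With this sign, separation at the scaled signed power of \<open>x\<close> yields
    \<open>b < - (N * m)\<close>.\<close>
  define \<epsilon> :: real where "\<epsilon> = (if y \<bullet> tensor_power x < 0 then -1 else 1)"
  have "N *\<^sub>R (\<epsilon> *\<^sub>R tensor_power x) \<in> ?K"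
    using x(1) by (intro imageI hull_inc)
      (unfold signed_powers_def mem_Collect_eq, intro exI[of _ \<epsilon>] exI[of _ x], simp add: \<epsilon>_def)
  from ab(2)[OF this] have "b < N * (\<epsilon> * (a \<bullet> tensor_power x))" by simp
  also have "\<dots> = - (N * m)"
    using ya[OF symmetric_tensor_power, of x] by (auto simp: \<epsilon>_def m_def)
  finally have "N * m < y \<bullet> A" using ab(1) ya[OF A] by simp
  moreover have le: "y \<bullet> A \<le> m * c" if cA: "c \<in> nuclear_costs A" for c
  proof -
    obtain r :: nat and u :: "'d \<Rightarrow> nat \<Rightarrow> real ^ 'n" where
      c: "c = (\<Sum>i<r. \<Prod>k\<in>UNIV. norm (u k i))" and Au: "A = (\<Sum>i<r. rank_one_tensor (\<lambda>k. u k i))"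
      using cA unfolding nuclear_costs_def by blast
    have "y \<bullet> A = (\<Sum>i<r. y \<bullet> rank_one_tensor (\<lambda>k. u k i))"
      unfolding Au by (rule inner_sum_right)
    also have "\<dots> \<le> (\<Sum>i<r. m * (\<Prod>k\<in>UNIV. norm (u k i)))"
      using norm_bound_rank_one[OF x(2)] unfolding m_def by (intro sum_mono) (metis abs_le_D1)
    finally show ?thesis by (simp add: c sum_distrib_left)
  qed
  moreover have "y \<bullet> A \<le> m * N"
  \<comment> \<open>For \<open>m = 0\<close> any single cost gives
    \<open>y \<bullet> A \<le> 0\<close>; otherwise \<open>y \<bullet> A / m\<close> is a lower
    bound of all costs, hence of their infimum \<open>N\<close>.\<close>
  proof (cases "m = 0")
    case True
    then show ?thesis using le nuclear_costs_nonempty[of A] by auto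
  next
    case False
    then have "m > 0" by (simp add: m_def)
    then have "y \<bullet> A / m \<le> N"
      unfolding N_def nuclear_norm_eq using le
      by (intro cInf_greatest nuclear_costs_nonempty) (simp add: field_simps)
    then show ?thesis using \<open>m > 0\<close> by (simp add: field_simps)
  qed
  ultimately show False by (simp add: mult.commute)
qed

text \<open>Each weight \<open>c * l i\<close> of a convex combination is nonnegative, so its root
  of order \<open>CARD('d)\<close> can be moved into the unit vector. The costs then add up to
  \<open>c\<close> times the total weight 1.\<close>

lemma symmetric_cost_of_scaled_hull:
  fixes A :: "('n::finite, 'd::finite) tensor"
  assumes "c \<ge> 0" "A \<in> (*\<^sub>R) c ` (convex hull signed_powers)"
  shows "c \<in> symmetric_decomposition_costs A"
proof -
  obtain y where y: "y \<in> convex hull signed_powers" "A = c *\<^sub>R y"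
    using assms(2) by blast
  obtain n :: nat and l :: "nat \<Rightarrow> real" and s :: "nat \<Rightarrow> ('n, 'd) tensor"
    where l: "\<And>i. i \<in> {1..n} \<Longrightarrow> 0 \<le> l i \<and> s i \<in> signed_powers" "sum l {1..n} = 1"
      and ys: "(\<Sum>i = 1..n. l i *\<^sub>R s i) = y"
    using y(1) unfolding convex_hull_indexed by blast
  have "\<forall>i\<in>{1..n}. \<exists>\<epsilon> x. s i = \<epsilon> *\<^sub>R tensor_power x \<and> \<epsilon> \<in> {-1, 1} \<and> norm x = 1"
    using l(1) unfolding signed_powers_def by blast
  then obtain \<epsilon> x where sx: "\<And>i. i \<in> {1..n} \<Longrightarrow>
      s i = \<epsilon> i *\<^sub>R tensor_power (x i) \<and> \<epsilon> i \<in> {-1, 1} \<and> norm (x i) = 1"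
    by metis
  define t where "t i = root CARD('d) (c * l i)" for i
  have t: "t i ^ CARD('d) = c * l i" "t i \<ge> 0" if "i \<in> {1..n}" for i
    using l(1)[OF that] assms(1) by (auto simp: t_def)
  have shift: "sum g {1..n} = (\<Sum>i<n. g (Suc i))" for g :: "nat \<Rightarrow> 'a::comm_monoid_add"
    by (simp add: sum.atLeast1_atMost_eq)
  have "A = (\<Sum>i = 1..n. \<epsilon> i *\<^sub>R tensor_power (t i *\<^sub>R x i))"
    unfolding y(2) ys[symmetric] scaleR_sum_right
    by (rule sum.cong) (simp_all add: tensor_power_scaleR t sx mult_ac)
  moreover have "c = (\<Sum>i = 1..n. norm (t i *\<^sub>R x i) ^ CARD('d))"
  proof -
    have "(\<Sum>i = 1..n. norm (t i *\<^sub>R x i) ^ CARD('d)) = (\<Sum>i = 1..n. c * l i)"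
      by (rule sum.cong) (simp_all add: t sx)
    also have "\<dots> = c" using l(2) by (simp flip: sum_distrib_left)
    finally show ?thesis ..
  qed
  moreover have "\<forall>i<n. \<epsilon> (Suc i) \<in> {-1, 1}" using sx by simp
  ultimately show ?thesis
    unfolding symmetric_decomposition_costs_def shift mem_Collect_eq
    by (intro exI[of _ n] exI[of _ "\<lambda>i. t (Suc i) *\<^sub>R x (Suc i)"] exI[of _ "\<lambda>i. \<epsilon> (Suc i)"]) simp
qed

theorem theorem5p1:
  fixes A :: "('n::finite, 'd::finite) tensor"
  assumes "symmetric_tensor A"
  shows "nuclear_norm A = Inf (symmetric_decomposition_costs A)
    \<and> Inf (symmetric_decomposition_costs A) \<in> symmetric_decomposition_costs A
    \<and> (\<forall>c\<in>symmetric_decomposition_costs A. nuclear_norm A \<le> c)"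
proof -
  have "nuclear_norm A \<ge> 0"
    unfolding nuclear_norm_eq
    by (intro cInf_greatest nuclear_costs_nonempty nuclear_costs_nonneg)
  \<comment> \<open>Membership of the nuclear norm itself makes it the minimum, once it is known to
    be a lower bound.\<close>
  then have mem: "nuclear_norm A \<in> symmetric_decomposition_costs A"
    by (intro symmetric_cost_of_scaled_hull nuclear_norm_mem_scaled_hull assms)
  have le: "nuclear_norm A \<le> c" if "c \<in> symmetric_decomposition_costs A" for c
    unfolding nuclear_norm_eq
    using that symmetric_costs_subset by (intro cInf_lower bdd_below_nuclear_costs) blast
  have "Inf (symmetric_decomposition_costs A) = nuclear_norm A"
    using mem le by (rule cInf_eq_minimum)
  with mem le show ?thesis by simp
qed

end
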